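(* Let $f,g\in\mathcal Q^n$ be such that $f\vee g\in\mathcal Q^n$. Then for every $i=0,1,\dots,n-1$, $$W_i(f\wedge g)+W_i(f\vee g)=W_i(f)+W_i(g).$$
   Context: $\mathcal Q^n$ is the set of functions $f:\mathbb R^n\to[0,+\infty]$ that are not identically zero, quasi-concave (all sets $\{f\ge t\}$ convex), upper semicontinuous, and satisfy $\lim_{\|x\|\to\infty}f(x)=0$. $f\vee g$ and $f\wedge g$ are the pointwise maximum and minimum. For a non-empty compact convex $K\subset\mathbb R^n$, the quermassintegrals $W_i(K)$ are defined by $\mathcal H^n(K+\rho B)=\sum_{i=0}^n\binom ni W_i(K)\rho^i$ for all $\rho\ge0$ ($B$ the closed Euclidean unit ball, $\mathcal H^n$ Lebesgue measure); $W_i(\emptyset)=0$. For a function $f$ with compact convex level sets $\{f\ge t\}$, $t>0$, $W_i(f)=\int_0^{+\infty}W_i(\{f\ge t\})\,dt\in[0,+\infty]$. *)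

theory Defs
  imports "HOL-Analysis.Analysis"
begin

text \<open>The ambient space is \<^typ>\<open>real ^ 'n\<close>, whose dimension is \<^term>\<open>CARD('n)\<close>.\<close>

definition upper_semicontinuous :: "(real ^ 'n \<Rightarrow> ennreal) \<Rightarrow> bool" where
  "upper_semicontinuous f \<longleftrightarrow> (\<forall>x. \<forall>c > f x. eventually (\<lambda>y. f y < c) (nhds x))"

definition quasi_concave :: "(real ^ 'n \<Rightarrow> ennreal) \<Rightarrow> bool" where
  "quasi_concave f \<longleftrightarrow> (\<forall>t. convex {x. f x \<ge> t})"

definition Q_class :: "(real ^ 'n \<Rightarrow> ennreal) set" where
  "Q_class = {f. (\<exists>x. f x \<noteq> 0) \<and> quasi_concave f \<and> upper_semicontinuous f
                 \<and> (f \<longlongrightarrow> 0) at_infinity}"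

definition parallel_body :: "(real ^ 'n) set \<Rightarrow> real \<Rightarrow> (real ^ 'n) set" where
  "parallel_body K \<rho> = {x + \<rho> *\<^sub>R b |x b. x \<in> K \<and> b \<in> cball 0 1}"

definition steiner_coeffs :: "(real ^ 'n) set \<Rightarrow> (nat \<Rightarrow> real) \<Rightarrow> bool" where
  "steiner_coeffs K w \<longleftrightarrow>
     (\<forall>\<rho>\<ge>0. measure lebesgue (parallel_body K \<rho>)
            = (\<Sum>i=0..CARD('n). real (CARD('n) choose i) * w i * \<rho> ^ i))"

text \<open>
  The Steiner identity determines only the values \<open>w i\<close> with \<open>i \<le> CARD('n)\<close>. The values
  beyond the dimension are set to \<open>0\<close> so that the description is unique.
\<close>
definition quermass :: "nat \<Rightarrow> (real ^ 'n) set \<Rightarrow> real" where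
  "quermass i K =
     (if K = {} then 0
      else (THE w. steiner_coeffs K w \<and> (\<forall>j>CARD('n). w j = 0)) i)"

text \<open>
  Quermassintegrals of compact convex sets are nonnegative, so the coercion \<^const>\<open>ennreal\<close>
  (which sends negative reals to \<open>0\<close>) does not truncate anything.
\<close>
definition quermass_fun :: "nat \<Rightarrow> (real ^ 'n \<Rightarrow> ennreal) \<Rightarrow> ennreal" where
  "quermass_fun i f =
     (\<integral>\<^sup>+t\<in>{0<..}. ennreal (quermass i {x. f x \<ge> ennreal t}) \<partial>lborel)"

end

theory Submission
  imports Defs
begin

text \<open>
  For \<open>t > 0\<close> the level sets \<open>K = {f \<ge> t}\<close> and \<open>L = {g \<ge> t}\<close> are compact and convex, those of
  \<open>f \<and> g\<close> and \<open>f \<or> g\<close> are \<open>K \<inter> L\<close> and \<open>K \<union> L\<close>, and \<open>K \<union> L\<close> is convex. So the claim follows by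
  integration over \<open>t\<close> once \<open>W\<^sub>i\<close> is known to be a valuation: \<open>W\<^sub>i(K \<inter> L) + W\<^sub>i(K \<union> L) = W\<^sub>i(K) + W\<^sub>i(L)\<close>
  (\<open>quermass_valuation\<close>). Volume is a valuation, and if \<open>K \<union> L\<close> is convex, then taking parallel bodies
  commutes with both union and intersection (\<open>parallel_body_Int\<close>): if a point is within \<open>\<rho>\<close> of
  \<open>k \<in> K\<close> and of \<open>l \<in> L\<close>, then the segment from \<open>k\<close> to \<open>l\<close>, being connected and covered by the closed
  sets \<open>K\<close> and \<open>L\<close>, meets \<open>K \<inter> L\<close>. Hence \<open>\<rho> \<mapsto> vol(K + \<rho>B)\<close> is a valuation, and so are its
  coefficients, because the coefficients of a polynomial of degree at most \<open>n\<close> are fixed linear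
  combinations of its values at \<open>0, \<dots>, n\<close> (\<open>coeff_from_values\<close>). The same linear combinations show
  that \<open>t \<mapsto> W\<^sub>i({f \<ge> t})\<close> is measurable, since \<open>vol({f \<ge> t} + jB)\<close> decreases in \<open>t\<close>.

  The substance is that \<open>W\<^sub>i\<close> is well defined and nonnegative, i.e. that \<open>vol(K + \<rho>B)\<close> is a polynomial
  in \<open>\<rho>\<close> with nonnegative coefficients (\<open>Steiner_formula\<close>). For a polytope \<open>P\<close>, sort the points of
  \<open>P + sB\<close> by the face \<open>F\<close> whose relative interior contains the nearest point of \<open>P\<close>. Moving away from
  \<open>P\<close> along the ray from the nearest point maps the cell of \<open>F\<close> in \<open>P + B\<close> onto the cell of \<open>F\<close> in
  \<open>P + sB\<close>; on this cell the map fixes the directions of \<open>F\<close> and multiplies the orthogonal ones by \<open>s\<close>,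
  so it multiplies volume by \<open>s ^ (n - dim F)\<close> (\<open>measure_face_cell\<close>). Summing over the faces gives
  the polynomial. A compact convex \<open>K\<close> lies between inscribed polytopes and their small parallel
  bodies, and the resulting polynomials converge pointwise, hence coefficientwise, to
  \<open>vol(K + \<rho>B)\<close>.
\<close>

section \<open>Lebesgue measure under orthogonal maps and partial dilations\<close>

text \<open>
  The elimination argument behind \<open>measure_orthogonal_image\<close> works through the coordinates in order,
  so it concerns well-ordered index types. An arbitrary finite index type is in bijection with the
  following ordered copy, and relabelling the coordinates preserves Lebesgue measure, so the result
  carries over.
\<close>
typedef ('n::finite) ordered_index = "{..<CARD('n)}"
  by (rule exI[of _ 0]) simp


instantiation ordered_index :: (finite) wellorder
begin
definition less_eq_ordered_index :: "'a ordered_index \<Rightarrow> 'a ordered_index \<Rightarrow> bool"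
  where "a \<le> b \<longleftrightarrow> Rep_ordered_index a \<le> Rep_ordered_index b"
definition less_ordered_index :: "'a ordered_index \<Rightarrow> 'a ordered_index \<Rightarrow> bool"
  where "a < b \<longleftrightarrow> Rep_ordered_index a < Rep_ordered_index b"
instance
proof
  fix P :: "'a ordered_index \<Rightarrow> bool" and a
  assume step: "\<And>x. (\<And>y. y < x \<Longrightarrow> P y) \<Longrightarrow> P x"
  show "P a"
    by (induction a rule: measure_induct_rule[of Rep_ordered_index])
      (use step in \<open>simp add: less_ordered_index_def\<close>)
qed (auto simp: less_eq_ordered_index_def less_ordered_index_def Rep_ordered_index_inject)
end

lemma bij_betw_Rep_ordered_index:
  "bij_betw (Rep_ordered_index :: 'n::finite ordered_index \<Rightarrow> nat) UNIV {..<CARD('n)}"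
  by (metis Rep_ordered_index_inject bij_betw_def inj_onI
      type_definition.Rep_range[OF type_definition_ordered_index])

instance ordered_index :: (finite) finite
proof
  show "finite (UNIV :: 'a ordered_index set)"
    using bij_betw_finite[OF bij_betw_Rep_ordered_index] by simp
qed

lemma ex_bij_ordered_index: "\<exists>g :: 'n::finite ordered_index \<Rightarrow> 'n. bij g"
  using bij_betw_same_card[OF bij_betw_Rep_ordered_index, where 'n1='n]
  by (metis card_lessThan finite finite_same_card_bij)

lemma prod_Basis_cart: "(\<Prod>b\<in>Basis. (v::real^'n) \<bullet> b) = (\<Prod>i\<in>UNIV. v $ i)"
proof -
  have Basis: "(Basis :: (real^'n) set) = range (\<lambda>i. axis i 1)"
    by (auto simp: Basis_vec_def)
  have "inj (\<lambda>i::'n. axis i (1::real))"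
    by (simp add: inj_on_def axis_eq_axis)
  then show ?thesis
    unfolding Basis by (subst prod.reindex) (simp_all add: inner_axis)
qed

lemma linear_reindex: "linear (\<lambda>x::real^'n. (\<chi> i. x $ g i) :: real^'m)"
  by (auto intro!: linearI simp: vec_eq_iff)

lemma distr_lborel_reindex:
  fixes g :: "'m::finite \<Rightarrow> 'n::finite"
  assumes "bij g"
  shows "distr lborel borel (\<lambda>x::real^'n. (\<chi> i. x $ g i) :: real^'m) = lborel"
    (is "distr _ _ ?H = _")
proof (rule lborel_eqI[symmetric])
  have H: "?H \<in> borel_measurable borel"
    by (intro borel_measurable_continuous_onI linear_continuous_on linear_reindex
        linear_conv_bounded_linear[THEN iffD1])
  fix l u :: "real^'m"
  assume lu: "\<And>b. b \<in> Basis \<Longrightarrow> l \<bullet> b \<le> u \<bullet> b"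
  have le: "l $ i \<le> u $ i" for i
    using lu[of "axis i 1"] by (simp add: inner_axis axis_in_Basis_iff)
  have vimage: "?H -` box l u = box (\<chi> j. l $ inv g j) (\<chi> j. u $ inv g j)"
    using assms by (auto simp: mem_box_cart bij_is_inj bij_is_surj surj_f_inv_f)
      (metis assms bij_inv_eq_iff)+
  have "emeasure (distr lborel borel ?H) (box l u)
      = emeasure lborel (box (\<chi> j. l $ inv g j) (\<chi> j. u $ inv g j))"
    using H by (simp add: emeasure_distr vimage)
  also have "\<dots> = ennreal (\<Prod>b\<in>Basis. ((\<chi> j. u $ inv g j) - (\<chi> j. l $ inv g j)) \<bullet> b)"
    by (subst emeasure_lborel_box) (auto simp: Basis_vec_def inner_axis le)
  also have "(\<Prod>b\<in>Basis. ((\<chi> j. u $ inv g j) - (\<chi> j. l $ inv g j)) \<bullet> b)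
      = (\<Prod>j\<in>UNIV. (u - l) $ inv g j)"
    by (subst prod_Basis_cart) simp
  also have "\<dots> = (\<Prod>b\<in>Basis. (u - l) \<bullet> b)"
    unfolding prod_Basis_cart
    by (rule prod.reindex_bij_betw) (simp add: assms bij_imp_bij_inv)
  finally show "emeasure (distr lborel borel ?H) (box l u) = ennreal (\<Prod>b\<in>Basis. (u - l) \<bullet> b)" .
qed simp

lemma borel_continuous_inverse_image:
  fixes S :: "'a::topological_space set"
  assumes S: "S \<in> sets borel" and cont: "continuous_on UNIV f'"
    and inv: "\<And>x. f' (f x) = x" "\<And>y. f (f' y) = y"
  shows "f ` S = f' -` S" "f ` S \<in> sets borel"
proof -
  show eq: "f ` S = f' -` S"
    using inv by (auto simp: image_iff) metis
  show "f ` S \<in> sets borel"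
    using measurable_sets_borel[OF borel_measurable_continuous_onI[OF cont] S] by (simp add: eq)
qed

text \<open>
  Conjugation with a relabelling of the coordinates turns \<open>f\<close> into an orthogonal map on a space
  with ordered index type. Borel sets suffice below, and for them images under the relabelling are
  preimages under its continuous inverse.
\<close>
lemma measure_orthogonal_image_borel:
  fixes f :: "real^'n \<Rightarrow> real^'n"
  assumes f: "orthogonal_transformation f" and S: "S \<in> sets borel" "bounded S"
  shows "measure lborel (f ` S) = measure lborel S"
proof -
  obtain g :: "'n ordered_index \<Rightarrow> 'n" where g: "bij g"
    using ex_bij_ordered_index by blast
  define H :: "real^'n \<Rightarrow> real^'n ordered_index" where "H = (\<lambda>x. \<chi> i. x $ g i)"
  define K :: "real^'n ordered_index \<Rightarrow> real^'n" where "K = (\<lambda>y. \<chi> j. y $ inv g j)"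
  have KH: "K (H x) = x" and HK: "H (K y) = y" for x y
    using g by (simp_all add: H_def K_def vec_eq_iff bij_is_inj bij_is_surj surj_f_inv_f)
  have linH: "linear H" and linK: "linear K"
    unfolding H_def K_def by (rule linear_reindex)+
  have contH: "continuous_on A H" and contK: "continuous_on B K" for A B
    using linH linK by (simp_all add: linear_continuous_on linear_conv_bounded_linear)
  have H_image: "measure lborel (H ` A) = measure lborel A" "H ` A \<in> sets borel"
    if "A \<in> sets borel" for A
  proof -
    have eq: "H ` A = K -` A" and "H ` A \<in> sets borel"
      using borel_continuous_inverse_image[OF that contK KH HK] by auto
    have "measure lborel A = measure (distr lborel borel K) A"
      unfolding K_def using g by (simp add: distr_lborel_reindex bij_imp_bij_inv)
    also have "\<dots> = measure lborel (K -` A)"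
      using contK that by (simp add: measure_distr borel_measurable_continuous_onI)
    finally show "measure lborel (H ` A) = measure lborel A" by (simp add: eq)
    show "H ` A \<in> sets borel" by fact
  qed
  have norm_H: "norm (H x) = norm x" for x
    using sum.reindex_bij_betw[OF g, of "\<lambda>i. (norm (x $ i))\<^sup>2"]
    by (simp add: H_def norm_vec_def L2_set_def)
  have norm_K: "norm (K y) = norm y" for y
    using norm_H[of "K y"] by (simp add: HK)
  have f': "orthogonal_transformation (H \<circ> f \<circ> K)"
    using f linH linK
    by (auto simp: orthogonal_transformation norm_H norm_K intro!: linear_compose)
  have HS: "H ` S \<in> lmeasurable"
  proof (rule bounded_set_imp_lmeasurable)
    show "bounded (H ` S)"
      using S(2) linH by (simp add: bounded_linear_image linear_conv_bounded_linear)
  qed (use H_image(2)[OF S(1)] in simp)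
  have fS: "f ` S \<in> sets borel"
  proof (rule borel_continuous_inverse_image(2)[OF S(1)])
    show "continuous_on UNIV (inv f)"
      by (simp add: f linear_continuous_on linear_conv_bounded_linear[symmetric]
          orthogonal_transformation_inv orthogonal_transformation_linear)
  qed (use f in \<open>simp_all add: orthogonal_transformation_inj orthogonal_transformation_surj surj_f_inv_f\<close>)
  have "measure lborel (f ` S) = measure lborel (H ` f ` S)"
    using H_image fS by simp
  also have "H ` f ` S = (H \<circ> f \<circ> K) ` H ` S"
    by (simp add: image_comp o_def KH)
  also have "measure lborel \<dots> = measure lebesgue \<dots>"
    using H_image(2)[OF fS] unfolding calculation(1)
    by (metis (no_types, lifting) \<open>H ` f ` S = (H \<circ> f \<circ> K) ` H ` S\<close> measure_completion sets_lborel)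
  also have "\<dots> = measure lebesgue (H ` S)"
    by (rule measure_orthogonal_image[OF f' HS])
  also have "\<dots> = measure lborel S"
    using H_image[OF S(1)] by simp
  finally show ?thesis .
qed

text \<open>
  Indexing the basis by the coordinates themselves makes the change of basis an endomorphism of
  \<open>real^'n\<close>.
\<close>
lemma orthonormal_basis_adapted:
  fixes L :: "(real^'n) set"
  assumes "subspace L"
  obtains e :: "'n \<Rightarrow> real^'n" and I
  where "\<And>i j. e i \<bullet> e j = (if i = j then 1 else 0)"
    "span (e ` I) = L" "e ` (- I) \<subseteq> L\<^sup>\<bottom>" "card I = dim L"
proof -
  obtain B where B: "B \<subseteq> L" "pairwise orthogonal B" "\<And>x. x \<in> B \<Longrightarrow> norm x = 1"
      "independent B" "card B = dim L" "span B = L"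
    using orthonormal_basis_subspace[OF assms] by blast
  obtain C where C: "C \<subseteq> L\<^sup>\<bottom>" "pairwise orthogonal C" "\<And>x. x \<in> C \<Longrightarrow> norm x = 1"
      "independent C" "card C = dim (L\<^sup>\<bottom>)" "span C = L\<^sup>\<bottom>"
    using orthonormal_basis_subspace[OF subspace_orthogonal_comp, of L] by blast
  have BC: "orthogonal x y" if "x \<in> B" "y \<in> C" for x y
    using that B(1) C(1) by (auto simp: orthogonal_comp_def)
  have orth: "pairwise orthogonal (B \<union> C)"
    using B(2) C(2) BC unfolding pairwise_def by (metis Un_iff orthogonal_commute)
  have norm1: "norm x = 1" if "x \<in> B \<union> C" for x
    using that B(3) C(3) by blast
  then have indep: "independent (B \<union> C)"
    by (intro pairwise_orthogonal_independent orth) force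
  have "span (B \<union> C) = UNIV"
    using subspace_sum_orthogonal_comp[OF assms]
    by (simp add: span_Un B(6) C(6) set_plus_def) blast
  then have "card (B \<union> C) = CARD('n)"
    using indep by (metis dim_UNIV dim_eq_card DIM_cart DIM_real mult.right_neutral span_UNIV)
  moreover have "finite (B \<union> C)"
    using indep independent_imp_finite by blast
  ultimately obtain e where e: "bij_betw e (UNIV :: 'n set) (B \<union> C)"
    by (metis finite finite_same_card_bij)
  define I where "I = e -` B"
  have disj: "B \<inter> C = {}"
    using BC norm1 by (metis UnI1 disjoint_iff norm_zero orthogonal_self zero_neq_one)
  have eI: "e ` I = B"
    using e by (auto simp: I_def bij_betw_def image_iff)
  show thesis
  proof
    show "e i \<bullet> e j = (if i = j then 1 else 0)" for i j
    proof (cases "i = j")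
      case True
      have "norm (e j) = 1"
        by (metis e bij_betwE iso_tuple_UNIV_I norm1)
      then show ?thesis using True by (simp add: norm_eq_1)
    next
      case False
      then have "e i \<noteq> e j" "e i \<in> B \<union> C" "e j \<in> B \<union> C"
        using e by (auto simp: bij_betw_def inj_on_def)
      then show ?thesis
        using orth False by (auto simp: pairwise_def orthogonal_def)
    qed
    show "span (e ` I) = L" by (simp add: eI B(6))
    show "e ` (- I) \<subseteq> L\<^sup>\<bottom>"
      using e C(1) by (auto simp: I_def bij_betw_def)
    show "card I = dim L"
      using e eI B(5) by (metis bij_betw_def card_image inj_on_subset subset_UNIV)
  qed
qed

text \<open>
  In an orthonormal basis that extends one of \<open>L\<close> the required map is diagonal, with entry 1 for the
  basis vectors in \<open>L\<close> and \<open>s\<close> for the others; conjugating with an orthogonal map does not affect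
  volumes.
\<close>
lemma scale_orthogonal_complement:
  fixes L :: "(real^'n) set"
  assumes L: "subspace L" and s: "s > 0"
  obtains T :: "real^'n \<Rightarrow> real^'n"
  where "linear T" "\<And>v. v \<in> L \<Longrightarrow> T v = v" "\<And>v. v \<in> L\<^sup>\<bottom> \<Longrightarrow> T v = s *\<^sub>R v"
    "\<And>S. S \<in> sets borel \<Longrightarrow> bounded S \<Longrightarrow> measure lborel (T ` S) = s ^ (CARD('n) - dim L) * measure lborel S"
proof -
  obtain e :: "'n \<Rightarrow> real^'n" and I
    where e: "\<And>i j. e i \<bullet> e j = (if i = j then 1 else 0)"
      and I: "span (e ` I) = L" "e ` (- I) \<subseteq> L\<^sup>\<bottom>" "card I = dim L"
    using orthonormal_basis_adapted[OF L] by blast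
  define U where "U = (\<lambda>x::real^'n. \<Sum>i\<in>UNIV. (x $ i) *\<^sub>R e i)"
  define V where "V = (\<lambda>y. \<chi> i. y \<bullet> e i)"
  define m where "m = (\<lambda>i. if i \<in> I then 1 else s)"
  define D where "D = (\<lambda>x::real^'n. \<chi> i. m i * x $ i)"
  define T where "T = U \<circ> D \<circ> V"
  have linU: "linear U" and linV: "linear V" and linD: "linear D"
    unfolding U_def V_def D_def
    by (auto intro!: linearI simp: vec_eq_iff scaleR_add_left sum.distrib scaleR_right.sum
        inner_add_left algebra_simps)
  have VU: "V (U x) = x" for x
    by (simp add: V_def U_def vec_eq_iff inner_sum_left e if_distrib cong: if_cong)
  have normU: "norm (U x) = norm x" for x
  proof -
    have "U x \<bullet> U x = (\<Sum>i\<in>UNIV. x $ i * (U x \<bullet> e i))"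
      by (subst (2) U_def) (simp add: inner_sum_right)
    also have "\<dots> = x \<bullet> x"
      using VU[of x] by (simp add: V_def vec_eq_iff inner_vec_def)
    finally show ?thesis by (simp add: norm_eq)
  qed
  have orthU: "orthogonal_transformation U"
    by (simp add: orthogonal_transformation linU normU)
  have UV: "U (V y) = y" for y
    by (metis VU orthU orthogonal_transformation_surj surjD)
  have V_inv: "V = inv U"
    by (metis UV VU inv_equality)
  have orthV: "orthogonal_transformation V"
    unfolding V_inv by (rule orthogonal_transformation_inv[OF orthU])
  have linT: "linear T"
    unfolding T_def by (intro linear_compose linU linV linD)
  have Te: "T (e i) = m i *\<^sub>R e i" for i
  proof -
    have "V (e i) = axis i 1" by (simp add: V_def e vec_eq_iff axis_def)
    then have "D (V (e i)) = m i *\<^sub>R axis i 1" by (simp add: D_def vec_eq_iff axis_def)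
    then have "T (e i) = m i *\<^sub>R U (axis i 1)"
      by (simp add: T_def linear_scale[OF linU])
    also have "U (axis i 1) = e i" by (simp add: U_def axis_def if_distrib[of "\<lambda>c. c *\<^sub>R _"] cong: if_cong)
    finally show ?thesis .
  qed
  show thesis
  proof
    show "linear T" by fact
    show "T v = v" if "v \<in> L" for v
    proof (rule linear_eq_on[OF linT linear_ident])
      show "v \<in> span (e ` I)" using that by (simp add: I(1))
    qed (auto simp: Te m_def)
    show "T v = s *\<^sub>R v" if v: "v \<in> L\<^sup>\<bottom>" for v
    proof -
      have "v \<bullet> e i = 0" if "i \<in> I" for i
        using v that I(1) span_base[of "e i" "e ` I"]
        by (auto simp: orthogonal_comp_def orthogonal_def inner_commute)
      then have "D (V v) = s *\<^sub>R V v"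
        by (auto simp: D_def V_def m_def vec_eq_iff)
      then show ?thesis
        by (simp add: T_def linear_scale[OF linU] UV)
    qed
    fix S :: "(real^'n) set"
    assume S: "S \<in> sets borel" "bounded S"
    have cont: "continuous_on A f" if "linear f" for A and f :: "real^'n \<Rightarrow> real^'n"
      using that by (simp add: linear_continuous_on linear_conv_bounded_linear)
    have VS: "V ` S \<in> sets borel" "bounded (V ` S)"
      using borel_continuous_inverse_image(2)[OF S(1) cont[OF linU] UV VU] S(2) linV
      by (simp_all add: bounded_linear_image linear_conv_bounded_linear)
    have DVS: "D ` V ` S \<in> sets borel"
    proof (rule borel_continuous_inverse_image(2)[OF VS(1)])
      show "continuous_on UNIV (\<lambda>x::real^'n. \<chi> i. x $ i / m i)"
        by (intro cont linearI) (auto simp: vec_eq_iff add_divide_distrib)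
    qed (use s in \<open>auto simp: D_def m_def vec_eq_iff\<close>)
    have "bounded (D ` V ` S)"
      using VS(2) linD by (simp add: bounded_linear_image linear_conv_bounded_linear)
    then have "measure lborel (T ` S) = measure lborel (D ` V ` S)"
      using measure_orthogonal_image_borel[OF orthU DVS] by (simp add: T_def image_comp o_assoc)
    also have "\<dots> = measure lebesgue (D ` V ` S)" using DVS by simp
    also have "\<dots> = \<bar>prod m UNIV\<bar> * measure lebesgue (V ` S)"
      unfolding D_def using VS by (intro measure_stretch bounded_set_imp_lmeasurable) auto
    also have "measure lebesgue (V ` S) = measure lborel S"
      using VS measure_orthogonal_image_borel[OF orthV S] by simp
    also have "\<bar>prod m UNIV\<bar> = s ^ (CARD('n) - dim L)"
    proof -
      have "prod m UNIV = (\<Prod>i\<in>UNIV - I. s)"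
        unfolding m_def by (simp add: prod.If_cases Compl_eq_Diff_UNIV)
      also have "\<dots> = s ^ (CARD('n) - dim L)"
        by (simp add: card_Diff_subset I(3))
      finally show ?thesis using s by simp
    qed
    finally show "measure lborel (T ` S) = s ^ (CARD('n) - dim L) * measure lborel S" .
  qed
qed

section \<open>Parallel bodies of polytopes\<close>
lemma mem_parallel_body:
  assumes "\<rho> \<ge> 0"
  shows "x \<in> parallel_body K \<rho> \<longleftrightarrow> (\<exists>y\<in>K. dist x y \<le> \<rho>)"
proof
  assume "x \<in> parallel_body K \<rho>"
  then obtain y b where "y \<in> K" "norm b \<le> 1" "x = y + \<rho> *\<^sub>R b"
    by (auto simp: parallel_body_def)
  then show "\<exists>y\<in>K. dist x y \<le> \<rho>"
    using assms by (intro bexI[of _ y]) (auto simp: dist_norm mult_left_le)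
next
  assume "\<exists>y\<in>K. dist x y \<le> \<rho>"
  then obtain y where y: "y \<in> K" "dist x y \<le> \<rho>" by blast
  define b where "b = (x - y) /\<^sub>R \<rho>"
  have "norm b \<le> 1"
    using y(2) assms by (cases "\<rho> = 0") (auto simp: b_def dist_norm divide_simps simp del: scaleR_diff_right)
  moreover have "x = y + \<rho> *\<^sub>R b"
    using y(2) by (cases "\<rho> = 0") (auto simp: b_def)
  ultimately show "x \<in> parallel_body K \<rho>"
    using y(1) by (auto simp: parallel_body_def)
qed

text \<open>
  \<open>x - q\<close> lies in the normal cone of \<open>P\<close> at the nearest point \<open>q\<close>, and so does \<open>s (x - q)\<close>.
\<close>
lemma closest_point_outward:
  assumes P: "convex P" "closed P" "P \<noteq> {}" and s: "s \<ge> 0"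
  shows "closest_point P (closest_point P x + s *\<^sub>R (x - closest_point P x)) = closest_point P x"
    (is "closest_point P ?y = ?q")
proof (rule closest_point_unique[symmetric, OF P(1,2)])
  show "?q \<in> P" using P by (simp add: closest_point_in_set)
  show "\<forall>z\<in>P. dist ?y ?q \<le> dist ?y z"
  proof
    fix z assume "z \<in> P"
    define u w where "u = x - ?q" and "w = z - ?q"
    have "s * (u \<bullet> w) \<le> 0"
      using closest_point_dot[OF P(1,2) \<open>z \<in> P\<close>, of x] s
      by (simp add: u_def w_def mult_nonneg_nonpos)
    then have "(s *\<^sub>R u) \<bullet> (s *\<^sub>R u) \<le> (s *\<^sub>R u - w) \<bullet> (s *\<^sub>R u - w)"
      by (simp add: inner_diff_left inner_diff_right inner_commute) (smt (verit) inner_ge_zero)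
    then have "norm (s *\<^sub>R u) \<le> norm (s *\<^sub>R u - w)" by (simp only: norm_le)
    then show "dist ?y ?q \<le> dist ?y z"
      by (simp add: u_def w_def dist_norm algebra_simps)
  qed
qed

text \<open>
  Since \<open>q\<close> is in the relative interior of \<open>F\<close>, the segment from \<open>z\<close> to \<open>q\<close> can be prolonged within \<open>F\<close>
  beyond \<open>q\<close>. The normal cone inequality at \<open>q\<close> then holds in the direction of \<open>z - q\<close> and in the
  opposite one.
\<close>
lemma closest_point_normal_to_face:
  fixes P :: "'a::euclidean_space set"
  assumes P: "convex P" "closed P" and F: "F face_of P"
    and q: "closest_point P x \<in> rel_interior F" and z: "z \<in> F"
  shows "(x - closest_point P x) \<bullet> (z - closest_point P x) = 0"
proof -
  let ?q = "closest_point P x"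
  have sub: "F \<subseteq> P" using F face_of_imp_subset by blast
  obtain e where e: "e > 1" "(1 - e) *\<^sub>R z + e *\<^sub>R ?q \<in> F"
    using q z face_of_imp_convex[OF F] convex_rel_interior_iff[of F ?q] by blast
  have "(x - ?q) \<bullet> ((1 - e) *\<^sub>R z + e *\<^sub>R ?q - ?q) \<le> 0"
    using e(2) sub by (intro closest_point_dot P) auto
  also have "(1 - e) *\<^sub>R z + e *\<^sub>R ?q - ?q = (1 - e) *\<^sub>R (z - ?q)"
    by (simp add: algebra_simps)
  finally have "(x - ?q) \<bullet> (z - ?q) \<ge> 0"
    using e(1) by (simp add: mult_le_0_iff)
  moreover have "(x - ?q) \<bullet> (z - ?q) \<le> 0"
    using z sub by (intro closest_point_dot P) auto
  ultimately show ?thesis by simp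
qed

text \<open>
  For a face \<open>F\<close> of \<open>P\<close> this is the sum of the relative interior of \<open>F\<close> and the part of length at
  most \<open>r\<close> of the normal cone of \<open>P\<close> along \<open>F\<close>. The form with nearest points makes it obvious that
  the cells of different faces are disjoint, and that they are Borel sets.
\<close>
definition face_cell :: "(real^'n) set \<Rightarrow> (real^'n) set \<Rightarrow> real \<Rightarrow> (real^'n) set" where
  "face_cell P F r =
     {x. closest_point P x \<in> rel_interior F \<and> dist x (closest_point P x) \<le> r}"

lemma borel_rel_interior:
  fixes F :: "'a::euclidean_space set"
  assumes "closed F"
  shows "rel_interior F \<in> sets borel"
proof -
  have "rel_interior F = F - rel_frontier F"
    using assms rel_interior_subset[of F] by (auto simp: rel_frontier_def)
  then show ?thesis
    using assms closed_rel_frontier[of F] by (simp add: borel_closed sets.Diff)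
qed

lemma borel_face_cell:
  assumes P: "convex P" "closed P" "P \<noteq> {}" and F: "closed F"
  shows "face_cell P F r \<in> sets borel"
proof -
  have cont: "continuous_on UNIV (closest_point P)"
    using P by (rule continuous_on_closest_point)
  have "closest_point P -` rel_interior F \<in> sets borel"
    by (intro measurable_sets_borel[OF borel_measurable_continuous_onI[OF cont]]
        borel_rel_interior F)
  moreover have "closed {x. dist x (closest_point P x) \<le> r}"
    by (intro closed_Collect_le continuous_intros cont)
  moreover have "face_cell P F r
      = closest_point P -` rel_interior F \<inter> {x. dist x (closest_point P x) \<le> r}"
    by (auto simp: face_cell_def)
  ultimately show ?thesis by (simp add: borel_closed sets.Int)
qed

lemma bounded_parallel_body:
  assumes "bounded K" "r \<ge> 0"
  shows "bounded (parallel_body K r)"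
proof -
  obtain a where a: "norm y \<le> a" if "y \<in> K" for y
    using assms(1) by (auto simp: bounded_iff)
  have "norm x \<le> a + r" if x: "x \<in> parallel_body K r" for x
  proof -
    obtain y where "y \<in> K" "dist x y \<le> r"
      using x assms(2) by (auto simp: mem_parallel_body)
    then show ?thesis using a[of y] norm_triangle_sub[of x y] by (simp add: dist_norm)
  qed
  then show ?thesis by (auto simp: bounded_iff)
qed

lemma face_cell_subset_parallel_body:
  assumes "closed P" "P \<noteq> {}" "r \<ge> 0"
  shows "face_cell P F r \<subseteq> parallel_body P r"
  using closest_point_in_set[OF assms(1,2)] by (fastforce simp: face_cell_def mem_parallel_body assms(3))

text \<open>
  The nearest point does not change when a point moves on its ray, so stretching by \<open>1 / s\<close> undoes
  stretching by \<open>s\<close>.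
\<close>
lemma face_cell_stretch:
  assumes P: "convex P" "closed P" "P \<noteq> {}" and s: "s > 0"
  shows "face_cell P F s
    = (\<lambda>x. closest_point P x + s *\<^sub>R (x - closest_point P x)) ` face_cell P F 1"
proof (intro equalityI subsetI)
  fix y assume y: "y \<in> face_cell P F s"
  let ?q = "closest_point P y"
  define x where "x = ?q + (1 / s) *\<^sub>R (y - ?q)"
  have q: "closest_point P x = ?q"
    unfolding x_def using s by (intro closest_point_outward P) auto
  have "norm (x - ?q) \<le> 1"
    using y s by (simp add: face_cell_def x_def dist_norm divide_simps del: scaleR_diff_right)
  then have "x \<in> face_cell P F 1" using y q by (simp add: face_cell_def dist_norm)
  moreover have "y = closest_point P x + s *\<^sub>R (x - closest_point P x)"
    using s unfolding q by (simp add: x_def)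
  ultimately show "y \<in> (\<lambda>x. closest_point P x + s *\<^sub>R (x - closest_point P x)) ` face_cell P F 1"
    by blast
next
  fix y assume "y \<in> (\<lambda>x. closest_point P x + s *\<^sub>R (x - closest_point P x)) ` face_cell P F 1"
  then obtain x where x: "x \<in> face_cell P F 1"
      and y: "y = closest_point P x + s *\<^sub>R (x - closest_point P x)" by blast
  have q: "closest_point P y = closest_point P x"
    unfolding y using s by (intro closest_point_outward P) auto
  have "norm (s *\<^sub>R (x - closest_point P x)) \<le> s"
    using x s by (simp add: face_cell_def dist_norm)
  then have "dist y (closest_point P x) \<le> s"
    by (simp add: y dist_norm)
  then show "y \<in> face_cell P F s" using x by (simp add: face_cell_def q)
qed

text \<open>
  On the cell of \<open>F\<close>, the displacement \<open>x - q\<close> from the nearest point is orthogonal to \<open>F\<close>, while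
  \<open>q - a\<close> for a fixed \<open>a \<in> F\<close> is in the direction space \<open>L\<close> of \<open>F\<close>. Thus the stretching map agrees
  there with the affine map \<open>x \<mapsto> a + T (x - a)\<close>, where \<open>T\<close> is the identity on \<open>L\<close> and multiplication
  by \<open>s\<close> on the orthogonal complement.
\<close>
lemma measure_face_cell:
  fixes P :: "(real^'n) set"
  assumes P: "convex P" "compact P" "P \<noteq> {}" and F: "F face_of P" and s: "s > 0"
  shows "measure lborel (face_cell P F s)
    = s ^ (CARD('n) - nat (aff_dim F)) * measure lborel (face_cell P F 1)"
proof (cases "F = {}")
  case True
  then show ?thesis by (simp add: face_cell_def)
next
  case False
  then obtain a where a: "a \<in> F" by blast
  have clP: "closed P" using P(2) by (rule compact_imp_closed)
  have clF: "closed F" using face_of_imp_closed F P clP by blast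
  define L where "L = span ((+) (- a) ` F)"
  have dimL: "nat (aff_dim F) = dim L"
    using aff_dim_eq_dim[OF hull_inc[OF a]] by (simp add: L_def)
  have subL: "subspace L" by (simp add: L_def)
  have in_L: "z - a \<in> L" if "z \<in> F" for z
    unfolding L_def using that by (intro span_base) (auto simp: image_iff intro!: bexI[of _ z])
  obtain T :: "real^'n \<Rightarrow> real^'n" where T: "linear T" "\<And>v. v \<in> L \<Longrightarrow> T v = v"
      "\<And>v. v \<in> L\<^sup>\<bottom> \<Longrightarrow> T v = s *\<^sub>R v"
      "\<And>S. S \<in> sets borel \<Longrightarrow> bounded S \<Longrightarrow>
         measure lborel (T ` S) = s ^ (CARD('n) - dim L) * measure lborel S"
    using scale_orthogonal_complement[OF subL s] by blast
  have stretch: "closest_point P x + s *\<^sub>R (x - closest_point P x) = a + T (- a + x)"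
    if "x \<in> face_cell P F 1" for x
  proof -
    let ?q = "closest_point P x"
    have q: "?q \<in> rel_interior F" using that by (simp add: face_cell_def)
    then have "?q \<in> F" using rel_interior_subset by blast
    have "(x - ?q) \<bullet> w = 0" if "w \<in> L" for w
      using that unfolding L_def
    proof (induction rule: span_induct)
      case base
      show ?case by (auto simp: subspace_def inner_add_right)
    next
      case (step w)
      then obtain z where "z \<in> F" "w = z - a" by auto
      then have "w = (z - ?q) - (a - ?q)" by simp
      then show ?case
        using closest_point_normal_to_face[OF P(1) clP F q] \<open>z \<in> F\<close> a
        by (simp only: inner_diff_right mem_Collect_eq)
    qed
    then have "x - ?q \<in> L\<^sup>\<bottom>"
      by (simp add: orthogonal_comp_def orthogonal_def inner_commute)
    then have "T (x - ?q) = s *\<^sub>R (x - ?q)" by (rule T(3))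
    moreover have "T (?q - a) = ?q - a" using in_L[OF \<open>?q \<in> F\<close>] by (rule T(2))
    moreover have "T (- a + x) = T (?q - a) + T (x - ?q)"
      by (simp flip: linear_add[OF T(1)])
    ultimately show ?thesis by simp
  qed
  have C: "face_cell P F 1 \<in> sets borel" "bounded (face_cell P F 1)"
    using borel_face_cell[OF P(1) clP P(3) clF]
      bounded_subset[OF bounded_parallel_body face_cell_subset_parallel_body[OF clP P(3)]]
      compact_imp_bounded[OF P(2)] by auto
  have translate: "measure lborel ((+) b ` S) = measure lborel S" "(+) b ` S \<in> sets borel"
    if "S \<in> sets borel" for S and b :: "real^'n"
  proof -
    show bS: "(+) b ` S \<in> sets borel"
      by (rule borel_continuous_inverse_image(2)[OF that, of "\<lambda>x. x - b"])
        (auto intro!: continuous_intros)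
    show "measure lborel ((+) b ` S) = measure lborel S"
      using measure_translation[of b S] that bS by simp
  qed
  have "face_cell P F s = (\<lambda>x. a + T (- a + x)) ` face_cell P F 1"
    unfolding face_cell_stretch[OF P(1) clP P(3) s] by (rule image_cong[OF refl stretch])
  then have eq: "face_cell P F s = (+) a ` T ` (+) (- a) ` face_cell P F 1"
    by (simp add: image_comp o_def)
  have "T ` (+) (- a) ` face_cell P F 1 = (+) (- a) ` face_cell P F s"
    unfolding eq by (simp add: image_comp o_def)
  then have "measure lborel (face_cell P F s) = measure lborel (T ` (+) (- a) ` face_cell P F 1)"
    by (simp only: translate(1)[OF borel_face_cell[OF P(1) clP P(3) clF]])
  also have "\<dots> = s ^ (CARD('n) - dim L) * measure lborel ((+) (- a) ` face_cell P F 1)"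
    by (intro T(4) translate(2) bounded_translation C)
  finally show ?thesis
    unfolding translate(1)[OF C(1)] by (simp add: dimL)
qed

text \<open>
  A minimal face containing \<open>x\<close> works: if \<open>x\<close> were in its relative boundary, it would be in a
  smaller face.
\<close>
lemma ex_face_rel_interior:
  fixes P :: "'a::euclidean_space set"
  assumes "polytope P" "x \<in> P"
  obtains F where "F face_of P" "x \<in> rel_interior F"
proof -
  let ?\<F> = "{F. F face_of P \<and> x \<in> F}"
  have "finite ?\<F>"
    by (rule finite_subset[OF _ finite_polytope_faces[OF assms(1)]]) auto
  moreover have "P \<in> ?\<F>"
    using assms polytope_imp_convex face_of_refl by blast
  ultimately obtain F where F: "F \<in> ?\<F>" and min: "\<And>G. G \<in> ?\<F> \<Longrightarrow> G \<subseteq> F \<Longrightarrow> F = G"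
    using finite_has_minimal[of ?\<F>] by blast
  have poly: "polyhedron F"
    using F face_of_polytope_polytope[OF assms(1)] polytope_imp_polyhedron by blast
  have "x \<in> rel_interior F"
  proof (rule ccontr)
    assume "x \<notin> rel_interior F"
    then have "x \<in> rel_frontier F"
      using F closure_subset by (auto simp: rel_frontier_def)
    then obtain G where "G face_of F" "G \<noteq> F" "x \<in> G"
      by (auto simp: rel_frontier_of_polyhedron_alt[OF poly])
    then show False
      using F min[of G] face_of_trans[of G F P] face_of_imp_subset by blast
  qed
  then show thesis using F that by blast
qed

lemma measure_parallel_body_polytope:
  fixes P :: "(real^'n) set"
  assumes P: "polytope P" "P \<noteq> {}" and s: "s > 0"
  shows "measure lebesgue (parallel_body P s)
    = (\<Sum>F | F face_of P. s ^ (CARD('n) - nat (aff_dim F)) * measure lborel (face_cell P F 1))"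
proof -
  have conv: "convex P" and comp: "compact P" and clP: "closed P"
    using P(1) by (auto simp: polytope_imp_convex polytope_imp_compact polytope_imp_closed)
  let ?\<F> = "{F. F face_of P}"
  have cell: "face_cell P F s \<in> sets borel" "emeasure lborel (face_cell P F s) \<noteq> \<infinity>"
    if F: "F \<in> ?\<F>" for F
  proof -
    show borel: "face_cell P F s \<in> sets borel"
      using F conv clP P(2) by (intro borel_face_cell face_of_imp_closed[of P F]) auto
    have "bounded (face_cell P F s)"
      using bounded_subset[OF bounded_parallel_body face_cell_subset_parallel_body[OF clP P(2)]]
        compact_imp_bounded[OF comp] s by simp
    then show "emeasure lborel (face_cell P F s) \<noteq> \<infinity>"
      using emeasure_bounded_finite less_imp_neq by auto
  qed
  have disj: "disjoint_family_on (\<lambda>F. face_cell P F s) ?\<F>"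
    unfolding disjoint_family_on_def face_cell_def using face_of_eq by fastforce
  have "parallel_body P s = (\<Union>F\<in>?\<F>. face_cell P F s)"
  proof (intro equalityI subsetI)
    fix x assume "x \<in> parallel_body P s"
    then obtain y where "y \<in> P" "dist x y \<le> s" using s by (auto simp: mem_parallel_body)
    then have "dist x (closest_point P x) \<le> s"
      using closest_point_le[OF clP, of y x] by simp
    moreover obtain F where "F face_of P" "closest_point P x \<in> rel_interior F"
      using ex_face_rel_interior[OF P(1) closest_point_in_set[OF clP P(2)]] by blast
    ultimately show "x \<in> (\<Union>F\<in>?\<F>. face_cell P F s)" by (auto simp: face_cell_def)
  next
    fix x assume "x \<in> (\<Union>F\<in>?\<F>. face_cell P F s)"
    then show "x \<in> parallel_body P s"
      using face_cell_subset_parallel_body[OF clP P(2), of s] s by auto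
  qed
  then have "measure lborel (parallel_body P s) = (\<Sum>F\<in>?\<F>. measure lborel (face_cell P F s))"
    using cell disj by (auto intro!: measure_finite_Union finite_polytope_faces P(1))
  moreover have "parallel_body P s \<in> sets borel"
    unfolding \<open>parallel_body P s = _\<close>
    using cell(1) by (intro sets.finite_UN finite_polytope_faces P(1)) auto
  ultimately show ?thesis
    using measure_face_cell[OF conv comp P(2) _ s] by simp
qed

section \<open>The Steiner formula\<close>
lemma coeff_nonneg_power:
  fixes p :: "'a::linordered_idom poly"
  assumes "\<And>i. coeff p i \<ge> 0"
  shows "coeff (p ^ k) i \<ge> 0"
proof (induction k arbitrary: i)
  case (Suc k)
  show ?case using assms Suc by (auto simp: coeff_mult intro!: sum_nonneg)
qed (simp add: coeff_1)

text \<open>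
  Stretching is a bijection between cells only for positive radii. Shifting the radius by \<open>\<epsilon>\<close> makes the formula valid
  for all \<open>\<rho> \<ge> 0\<close>, and the shift keeps the coefficients nonnegative. It also turns \<open>P\<close> into the
  outer approximation that is used for a general convex body.
\<close>
lemma polytope_Steiner:
  fixes P :: "(real^'n) set"
  assumes P: "polytope P" "P \<noteq> {}" and \<epsilon>: "\<epsilon> > 0"
  obtains p :: "real poly" where "degree p \<le> CARD('n)" "\<And>i. coeff p i \<ge> 0"
    "\<And>\<rho>. \<rho> \<ge> 0 \<Longrightarrow> measure lebesgue (parallel_body P (\<rho> + \<epsilon>)) = poly p \<rho>"
proof
  let ?k = "\<lambda>F :: (real^'n) set. CARD('n) - nat (aff_dim F)"
  let ?p = "\<Sum>F | F face_of P. smult (measure lborel (face_cell P F 1)) ([:\<epsilon>, 1:] ^ ?k F)"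
  show "degree ?p \<le> CARD('n)"
  proof (intro degree_sum_le finite_polytope_faces P(1))
    fix F :: "(real^'n) set"
    show "degree (smult (measure lborel (face_cell P F 1)) ([:\<epsilon>, 1:] ^ ?k F)) \<le> CARD('n)"
      by (rule order_trans[OF degree_smult_le]) (simp add: degree_linear_power)
  qed
  show "coeff ?p i \<ge> 0" for i
    using \<epsilon> by (auto simp: coeff_sum coeff_pCons split: nat.split
        intro!: sum_nonneg mult_nonneg_nonneg coeff_nonneg_power)
  show "measure lebesgue (parallel_body P (\<rho> + \<epsilon>)) = poly ?p \<rho>" if "\<rho> \<ge> 0" for \<rho>
    using that \<epsilon> by (simp add: measure_parallel_body_polytope[OF P] poly_sum mult.commute add.commute)
qed

lemma polytope_approximation:
  fixes K :: "(real^'n) set"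
  assumes K: "compact K" "convex K" "K \<noteq> {}" and \<epsilon>: "\<epsilon> > 0"
  obtains P where "polytope P" "P \<noteq> {}" "P \<subseteq> K" "K \<subseteq> parallel_body P \<epsilon>"
proof -
  obtain N where N: "finite N" "N \<subseteq> K" "K \<subseteq> (\<Union>x\<in>N. ball x \<epsilon>)"
    using seq_compact_imp_totally_bounded[of K] K(1) \<epsilon> by (auto simp: compact_eq_seq_compact_metric)
  show thesis
  proof
    show "polytope (convex hull N)" using N(1) by (auto simp: polytope_def)
    show "convex hull N \<noteq> {}" using N(3) K(3) by auto
    show "convex hull N \<subseteq> K" using N(2) K(2) by (rule hull_minimal)
    show "K \<subseteq> parallel_body (convex hull N) \<epsilon>"
    proof
      fix x assume "x \<in> K"
      then obtain y where "y \<in> N" "dist x y < \<epsilon>" using N(3) by (auto simp: dist_commute)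
      then show "x \<in> parallel_body (convex hull N) \<epsilon>"
        using \<epsilon> hull_inc[of y N convex] by (auto simp: mem_parallel_body intro!: bexI[of _ y])
    qed
  qed
qed

lemma parallel_body_empty [simp]: "parallel_body {} r = {}"
  by (simp add: parallel_body_def)

lemma parallel_body_mono: "K \<subseteq> L \<Longrightarrow> parallel_body K r \<subseteq> parallel_body L r"
  by (auto simp: parallel_body_def)

lemma parallel_body_add:
  assumes "K \<subseteq> parallel_body L \<epsilon>" "\<rho> \<ge> 0" "\<epsilon> \<ge> 0"
  shows "parallel_body K \<rho> \<subseteq> parallel_body L (\<rho> + \<epsilon>)"
proof
  fix x assume "x \<in> parallel_body K \<rho>"
  then obtain y where y: "y \<in> K" "dist x y \<le> \<rho>" using assms by (auto simp: mem_parallel_body)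
  then obtain z where "z \<in> L" "dist y z \<le> \<epsilon>"
    using assms(1) mem_parallel_body[OF assms(3)] by blast
  then show "x \<in> parallel_body L (\<rho> + \<epsilon>)"
    using assms y(2) dist_triangle[of x z y] by (auto simp: mem_parallel_body intro!: bexI[of _ z])
qed

lemma parallel_body_eq_infdist:
  assumes "closed K" "K \<noteq> {}" "r \<ge> 0"
  shows "parallel_body K r = {x. infdist x K \<le> r}"
proof (intro equalityI subsetI)
  fix x assume x: "x \<in> {x. infdist x K \<le> r}"
  obtain y where "y \<in> K" "infdist x K = dist x y"
    using infdist_attains_inf[OF assms(1,2)] by blast
  then show "x \<in> parallel_body K r"
    using x by (auto simp: mem_parallel_body assms(3))
qed (use assms in \<open>auto simp: mem_parallel_body intro: infdist_le2\<close>)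

lemma compact_parallel_body:
  assumes "compact K" "r \<ge> 0"
  shows "compact (parallel_body K r)"
proof (cases "K = {}")
  case False
  have "closed {x. infdist x K \<le> r}"
    by (intro closed_Collect_le continuous_intros)
  then have "closed (parallel_body K r)"
    by (simp only: parallel_body_eq_infdist[OF compact_imp_closed[OF assms(1)] False assms(2)])
  then show ?thesis
    using bounded_parallel_body[OF compact_imp_bounded[OF assms(1)] assms(2)]
    by (simp only: compact_eq_bounded_closed)
qed simp

lemma measure_parallel_body_mono:
  assumes "compact K" "compact L" "parallel_body K r \<subseteq> parallel_body L r'" "r \<ge> 0" "r' \<ge> 0"
  shows "measure lebesgue (parallel_body K r) \<le> measure lebesgue (parallel_body L r')"
  by (intro measure_mono_fmeasurable assms fmeasurableD lmeasurable_compact compact_parallel_body)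

text \<open>
  Parallel bodies of a compact set are sublevel sets of the distance to it, so they shrink exactly
  to the closed parallel body of radius \<open>r\<close>.
\<close>
lemma measure_parallel_body_right_continuous:
  assumes K: "compact K" and r: "r \<ge> 0"
  shows "(\<lambda>m. measure lebesgue (parallel_body K (r + inverse (real (Suc m)))))
    \<longlonglongrightarrow> measure lebesgue (parallel_body K r)"
proof (cases "K = {}")
  case False
  let ?A = "\<lambda>m. parallel_body K (r + inverse (real (Suc m)))"
  have A: "?A m \<in> lmeasurable" for m
    using K r by (intro lmeasurable_compact compact_parallel_body) auto
  have A_eq: "?A m = {x. infdist x K \<le> r + inverse (real (Suc m))}" for m
    using K r False by (intro parallel_body_eq_infdist compact_imp_closed) auto
  have "(\<Inter>m. ?A m) = parallel_body K r"
  proof -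
    have lim: "(\<lambda>m. r + inverse (real (Suc m))) \<longlonglongrightarrow> r"
      using tendsto_add[OF tendsto_const LIMSEQ_inverse_real_of_nat, of r] by simp
    have "infdist x K \<le> r" if "\<And>m. infdist x K \<le> r + inverse (real (Suc m))" for x
      by (rule LIMSEQ_le_const[OF lim]) (use that in blast)
    moreover have "r \<le> r + inverse (real (Suc m))" for m by simp
    ultimately show ?thesis
      unfolding A_eq parallel_body_eq_infdist[OF compact_imp_closed[OF K] False r]
      by (auto intro: order_trans)
  qed
  moreover have "decseq ?A"
    unfolding A_eq by (intro decseq_SucI) (auto elim!: order_trans intro: le_imp_inverse_le)
  moreover have "range ?A \<subseteq> sets lebesgue"
    using A by (auto intro: fmeasurableD)
  moreover have "emeasure lebesgue (?A m) \<noteq> \<infinity>" for m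
    using fmeasurableD2[OF A] by simp
  ultimately show ?thesis
    using Lim_measure_decseq[of ?A lebesgue] by simp
qed simp

text \<open>
  Lagrange interpolation at \<open>0, \<dots>, n\<close>; the weights \<open>l i j\<close> do not depend on the polynomial. This is
  what carries limits, additivity and measurability from volumes of parallel bodies over to
  quermassintegrals.
\<close>
lemma coeff_from_values:
  obtains l :: "nat \<Rightarrow> nat \<Rightarrow> real"
  where "\<And>p i. degree p \<le> n \<Longrightarrow> coeff p i = (\<Sum>j\<le>n. l i j * poly p (real j))"
proof -
  \<comment> \<open>The Lagrange basis polynomials: \<open>B j\<close> is 1 at \<open>j\<close> and 0 at the other nodes.\<close>
  define B where "B = (\<lambda>j. \<Prod>m\<in>{..n} - {j}. smult (1 / (real j - real m)) [:- real m, 1:])"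
  have B: "poly (B j) (real k) = (if k = j then 1 else 0)" if "j \<le> n" "k \<le> n" for j k
  proof -
    have factor: "poly (B j) x = (\<Prod>m\<in>{..n} - {j}. (x - real m) / (real j - real m))" for x
      by (simp add: B_def poly_prod diff_divide_distrib)
    show ?thesis
    proof (cases "k = j")
      case True
      then show ?thesis by (simp add: factor)
    next
      case False
      then have "(\<Prod>m\<in>{..n} - {j}. (real k - real m) / (real j - real m)) = 0"
        using that by (intro prod_zero bexI[of _ k]) auto
      then show ?thesis using False by (simp add: factor)
    qed
  qed
  have degB: "degree (B j) \<le> n" if "j \<le> n" for j
  proof -
    have "degree (B j) \<le> (\<Sum>m\<in>{..n} - {j}. 1)"
      unfolding B_def by (intro order_trans[OF degree_prod_sum_le] sum_mono) auto
    then show ?thesis using that by simp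
  qed
  show thesis
  proof (rule that[of "\<lambda>i j. coeff (B j) i"])
    fix p :: "real poly" and i
    assume p: "degree p \<le> n"
    have "p = (\<Sum>j\<le>n. smult (poly p (real j)) (B j))" (is "_ = ?q")
    proof (rule poly_eqI_degree[of "real ` {..n}"])
      show "poly p x = poly ?q x" if x: "x \<in> real ` {..n}" for x
      proof -
        obtain k where k: "k \<le> n" "x = real k" using x by auto
        have "poly ?q x = (\<Sum>j\<le>n. if k = j then poly p (real j) else 0)"
          unfolding poly_sum k(2) by (intro sum.cong) (auto simp: B k(1))
        then show ?thesis using k by simp
      qed
      have "degree ?q \<le> n"
        by (intro degree_sum_le order_trans[OF degree_smult_le] degB) auto
      then show "degree ?q < card (real ` {..n})" by (simp add: card_image)
      show "degree p < card (real ` {..n})" using p by (simp add: card_image)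
    qed
    then have "coeff p i = coeff ?q i" by simp
    then show "coeff p i = (\<Sum>j\<le>n. coeff (B j) i * poly p (real j))"
      by (simp add: coeff_sum mult.commute)
  qed
qed

text \<open>
  An inscribed polytope \<open>P\<close> with \<open>K \<subseteq> P + \<epsilon>B\<close> satisfies
  \<open>vol(K + \<rho>B) \<le> vol(P + (\<rho> + \<epsilon>)B) \<le> vol(K + (\<rho> + \<epsilon>)B)\<close>, and the middle term is a polynomial in \<open>\<rho>\<close> with
  nonnegative coefficients. As \<open>\<epsilon>\<close> tends to 0 these polynomials converge to \<open>vol(K + \<rho>B)\<close> for
  every \<open>\<rho> \<ge> 0\<close>; since their degrees are bounded, their coefficients converge as well.
\<close>
theorem Steiner_formula:
  fixes K :: "(real^'n) set"
  assumes K: "compact K" "convex K" "K \<noteq> {}"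
  obtains p :: "real poly" where "degree p \<le> CARD('n)" "\<And>i. coeff p i \<ge> 0"
    "\<And>\<rho>. \<rho> \<ge> 0 \<Longrightarrow> measure lebesgue (parallel_body K \<rho>) = poly p \<rho>"
proof -
  let ?V = "\<lambda>\<rho>. measure lebesgue (parallel_body K \<rho>)"
  let ?e = "\<lambda>m. inverse (real (Suc m))"
  have "\<exists>p. degree p \<le> CARD('n) \<and> (\<forall>i. coeff p i \<ge> 0)
      \<and> (\<forall>\<rho>\<ge>0. ?V \<rho> \<le> poly p \<rho> \<and> poly p \<rho> \<le> ?V (\<rho> + ?e m))" for m
  proof -
    have e: "?e m > 0" by simp
    obtain P where P: "polytope P" "P \<noteq> {}" "P \<subseteq> K" "K \<subseteq> parallel_body P (?e m)"
      using polytope_approximation[OF K e] by blast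
    obtain p where p: "degree p \<le> CARD('n)" "\<And>i. coeff p i \<ge> 0"
        "\<And>\<rho>. \<rho> \<ge> 0 \<Longrightarrow> measure lebesgue (parallel_body P (\<rho> + ?e m)) = poly p \<rho>"
      using polytope_Steiner[OF P(1,2) e] by blast
    have "?V \<rho> \<le> poly p \<rho> \<and> poly p \<rho> \<le> ?V (\<rho> + ?e m)" if \<rho>: "\<rho> \<ge> 0" for \<rho>
    proof
      have cP: "compact P" using P(1) by (rule polytope_imp_compact)
      show "?V \<rho> \<le> poly p \<rho>"
        unfolding p(3)[OF \<rho>, symmetric] using \<rho> e
        by (intro measure_parallel_body_mono K cP parallel_body_add P(4)) auto
      show "poly p \<rho> \<le> ?V (\<rho> + ?e m)"
        unfolding p(3)[OF \<rho>, symmetric] using \<rho> e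
        by (intro measure_parallel_body_mono K cP parallel_body_mono P(3)) auto
    qed
    then show ?thesis using p(1,2) by blast
  qed
  then obtain p where deg: "\<And>m. degree (p m) \<le> CARD('n)"
      and nonneg: "\<And>m i. coeff (p m) i \<ge> 0"
      and bounds: "\<And>m \<rho>. \<rho> \<ge> 0 \<Longrightarrow> ?V \<rho> \<le> poly (p m) \<rho> \<and> poly (p m) \<rho> \<le> ?V (\<rho> + ?e m)"
    by metis
  have lim: "(\<lambda>m. poly (p m) \<rho>) \<longlonglongrightarrow> ?V \<rho>" if "\<rho> \<ge> 0" for \<rho>
    by (rule tendsto_sandwich[OF _ _ tendsto_const
          measure_parallel_body_right_continuous[OF K(1) that]])
      (use bounds[OF that] in auto)
  obtain l where l: "\<And>q i. degree q \<le> CARD('n) \<Longrightarrow>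
      coeff q i = (\<Sum>j\<le>CARD('n). l i j * poly q (real j))"
    using coeff_from_values[of "CARD('n)"] by metis
  define c where "c i = (\<Sum>j\<le>CARD('n). l i j * ?V (real j))" for i
  have c: "(\<lambda>m. coeff (p m) i) \<longlonglongrightarrow> c i" for i
    unfolding l[OF deg] c_def by (intro tendsto_intros lim) auto
  have c_nonneg: "c i \<ge> 0" for i
    using LIMSEQ_le_const[OF c] nonneg by blast
  let ?q = "\<Sum>i\<le>CARD('n). monom (c i) i"
  have poly_p: "poly (p m) x = (\<Sum>i\<le>CARD('n). coeff (p m) i * x ^ i)" for m x
    by (subst poly_as_sum_of_monoms'[OF deg, symmetric]) (simp add: poly_sum poly_monom)
  show thesis
  proof
    show "degree ?q \<le> CARD('n)"
      by (intro degree_sum_le order_trans[OF degree_monom_le]) auto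
    show "coeff ?q i \<ge> 0" for i
      by (auto simp: coeff_sum c_nonneg intro!: sum_nonneg)
    show "?V \<rho> = poly ?q \<rho>" if "\<rho> \<ge> 0" for \<rho>
    proof (rule LIMSEQ_unique[OF lim[OF that]])
      show "(\<lambda>m. poly (p m) \<rho>) \<longlonglongrightarrow> poly ?q \<rho>"
        unfolding poly_p poly_sum poly_monom by (intro tendsto_intros c)
    qed
  qed
qed

section \<open>Quermassintegrals of convex bodies\<close>

text \<open>
  A polynomial is determined by its values on \<open>[0, \<infinity>)\<close>, which gives the uniqueness that the
  definite description in the definition of \<^const>\<open>quermass\<close> requires.
\<close>
lemma quermass_eq_coeff:
  fixes K :: "(real^'n) set"
  assumes K: "K \<noteq> {}" and p: "degree p \<le> CARD('n)"
    and V: "\<And>\<rho>. \<rho> \<ge> 0 \<Longrightarrow> measure lebesgue (parallel_body K \<rho>) = poly p \<rho>"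
    and i: "i \<le> CARD('n)"
  shows "quermass i K = coeff p i / real (CARD('n) choose i)"
proof -
  let ?n = "CARD('n)"
  define w where "w = (\<lambda>i. coeff p i / real (?n choose i))"
  have w: "steiner_coeffs K w \<and> (\<forall>j>?n. w j = 0)"
  proof
    have "(\<Sum>i=0..?n. real (?n choose i) * w i * \<rho> ^ i) = poly p \<rho>" for \<rho>
      unfolding atMost_atLeast0[symmetric]
      by (subst poly_as_sum_of_monoms'[OF p, symmetric]) (simp add: poly_sum poly_monom w_def)
    then show "steiner_coeffs K w" by (simp add: steiner_coeffs_def V)
  qed (simp add: w_def)
  have unique: "v = w" if v: "steiner_coeffs K v \<and> (\<forall>j>?n. v j = 0)" for v
  proof
    fix j
    let ?q = "\<Sum>i\<le>?n. monom (real (?n choose i) * v i) i"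
    have "?q = p"
    proof (rule poly_eqI_degree[of "real ` {..?n}"])
      show "poly ?q x = poly p x" if "x \<in> real ` {..?n}" for x
      proof -
        have "x \<ge> 0" using that by auto
        then show ?thesis
          using v V[of x] by (simp add: steiner_coeffs_def poly_sum poly_monom atMost_atLeast0)
      qed
      have "degree ?q \<le> ?n"
        by (intro degree_sum_le order_trans[OF degree_monom_le]) auto
      then show "degree ?q < card (real ` {..?n})" by (simp add: card_image)
      show "degree p < card (real ` {..?n})" using p by (simp add: card_image)
    qed
    then have "coeff p j = coeff ?q j" by simp
    also have "\<dots> = (if j \<le> ?n then real (?n choose j) * v j else 0)"
      by (simp add: coeff_sum)
    finally show "v j = w j"
      using v by (cases "j \<le> ?n") (auto simp: w_def)
  qed
  have "(THE w. steiner_coeffs K w \<and> (\<forall>j>?n. w j = 0)) = w"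
    using w unique by (rule the_equality)
  then show ?thesis using K by (simp add: quermass_def w_def)
qed

lemma quermass_nonneg:
  fixes K :: "(real^'n) set"
  assumes K: "compact K" "convex K" and i: "i \<le> CARD('n)"
  shows "quermass i K \<ge> 0"
proof (cases "K = {}")
  case False
  obtain p :: "real poly" where p: "degree p \<le> CARD('n)" "\<And>i. coeff p i \<ge> 0"
    "\<And>\<rho>. \<rho> \<ge> 0 \<Longrightarrow> measure lebesgue (parallel_body K \<rho>) = poly p \<rho>"
    using Steiner_formula[OF K False] by blast
  show ?thesis using quermass_eq_coeff[OF False p(1,3) i] p(2)[of i] by simp
qed (simp add: quermass_def)

text \<open>
  The weights are the same for all convex bodies, and the formula also covers the empty set, where
  both sides vanish. So every linear identity between volumes of parallel bodies passes to
  quermassintegrals.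
\<close>
lemma quermass_from_volumes:
  assumes i: "i \<le> CARD('n::finite)"
  obtains c where "\<And>K :: (real^'n) set. compact K \<Longrightarrow> convex K \<Longrightarrow>
    quermass i K = (\<Sum>j\<le>CARD('n). c j * measure lebesgue (parallel_body K (real j)))"
proof -
  obtain l where l: "\<And>q i. degree q \<le> CARD('n) \<Longrightarrow>
      coeff q i = (\<Sum>j\<le>CARD('n). l i j * poly q (real j))"
    using coeff_from_values[of "CARD('n)"] by metis
  show thesis
  proof (rule that[of "\<lambda>j. l i j / real (CARD('n) choose i)"])
    fix K :: "(real^'n) set"
    assume K: "compact K" "convex K"
    show "quermass i K = (\<Sum>j\<le>CARD('n). l i j / real (CARD('n) choose i)
        * measure lebesgue (parallel_body K (real j)))"
    proof (cases "K = {}")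
      case False
      obtain p :: "real poly" where p: "degree p \<le> CARD('n)" "\<And>i. coeff p i \<ge> 0"
          "\<And>\<rho>. \<rho> \<ge> 0 \<Longrightarrow> measure lebesgue (parallel_body K \<rho>) = poly p \<rho>"
        using Steiner_formula[OF K False] by blast
      have "quermass i K = coeff p i / real (CARD('n) choose i)"
        by (rule quermass_eq_coeff[OF False p(1,3) i])
      also have "\<dots> = (\<Sum>j\<le>CARD('n). l i j * poly p (real j)) / real (CARD('n) choose i)"
        by (simp only: l[OF p(1)])
      finally show ?thesis
        by (simp add: p(3) sum_divide_distrib)
    qed (simp add: quermass_def)
  qed
qed

lemma parallel_body_Un: "parallel_body (K \<union> L) r = parallel_body K r \<union> parallel_body L r"
  by (auto simp: parallel_body_def)

text \<open>
  If \<open>x\<close> is within \<open>r\<close> of \<open>k \<in> K\<close> and of \<open>l \<in> L\<close>,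
  the segment from \<open>k\<close> to \<open>l\<close> stays in the ball of radius \<open>r\<close> about \<open>x\<close> and in \<open>K \<union> L\<close>; being
  connected, it meets \<open>K \<inter> L\<close>.
\<close>
lemma parallel_body_Int:
  assumes K: "closed K" and L: "closed L" and conv: "convex (K \<union> L)" and r: "r \<ge> 0"
  shows "parallel_body (K \<inter> L) r = parallel_body K r \<inter> parallel_body L r"
proof (intro equalityI subsetI)
  fix x assume "x \<in> parallel_body K r \<inter> parallel_body L r"
  then obtain k l where k: "k \<in> K" "dist x k \<le> r" and l: "l \<in> L" "dist x l \<le> r"
    using r by (auto simp: mem_parallel_body)
  have sub: "closed_segment k l \<subseteq> K \<union> L"
    using conv k l by (intro closed_segment_subset) auto
  have "K \<inter> L \<inter> closed_segment k l \<noteq> {}"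
  proof
    assume "K \<inter> L \<inter> closed_segment k l = {}"
    then show False
      using connected_closedD[OF connected_segment(1) _ sub K L] k(1) l(1) by auto
  qed
  then obtain m where m: "m \<in> K \<inter> L" "m \<in> closed_segment k l" by blast
  have "closed_segment k l \<subseteq> cball x r"
    using k l by (intro closed_segment_subset convex_cball) auto
  then have "dist x m \<le> r" using m(2) by auto
  then show "x \<in> parallel_body (K \<inter> L) r" using m(1) r by (auto simp: mem_parallel_body)
next
  fix x assume "x \<in> parallel_body (K \<inter> L) r"
  then show "x \<in> parallel_body K r \<inter> parallel_body L r"
    using parallel_body_mono[of "K \<inter> L" K r] parallel_body_mono[of "K \<inter> L" L r] by blast
qed

lemma quermass_valuation:
  fixes K L :: "(real^'n) set"
  assumes K: "compact K" "convex K" and L: "compact L" "convex L" and conv: "convex (K \<union> L)"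
    and i: "i \<le> CARD('n)"
  shows "quermass i (K \<inter> L) + quermass i (K \<union> L) = quermass i K + quermass i L"
proof -
  obtain c where c: "\<And>K :: (real^'n) set. compact K \<Longrightarrow> convex K \<Longrightarrow>
      quermass i K = (\<Sum>j\<le>CARD('n). c j * measure lebesgue (parallel_body K (real j)))"
    using quermass_from_volumes[OF i] by blast
  have volume: "measure lebesgue (parallel_body (K \<inter> L) (real j))
        + measure lebesgue (parallel_body (K \<union> L) (real j))
      = measure lebesgue (parallel_body K (real j)) + measure lebesgue (parallel_body L (real j))" for j
  proof -
    have "parallel_body K (real j) \<in> lmeasurable" "parallel_body L (real j) \<in> lmeasurable"
      by (auto intro!: lmeasurable_compact compact_parallel_body K L)
    from measure_Un3[OF this] show ?thesis
      using K L conv by (simp add: parallel_body_Un parallel_body_Int compact_imp_closed)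
  qed
  have "compact (K \<inter> L)" "convex (K \<inter> L)" "compact (K \<union> L)"
    using K L by (auto intro: compact_Int convex_Int compact_Un)
  then show ?thesis
    using K L conv by (simp add: c volume flip: sum.distrib distrib_left)
qed

section \<open>Integration over the level sets\<close>
lemma compact_level_set:
  assumes f: "f \<in> Q_class" and t: "t > 0"
  shows "compact {x. f x \<ge> ennreal t}"
proof -
  have usc: "upper_semicontinuous f" and lim: "(f \<longlongrightarrow> 0) at_infinity"
    using f by (auto simp: Q_class_def)
  have "open {x. f x < ennreal t}"
    using usc unfolding upper_semicontinuous_def eventually_nhds
    by (subst open_subopen) fastforce
  moreover have "{x. f x \<ge> ennreal t} = - {x. f x < ennreal t}" by auto
  ultimately have "closed {x. f x \<ge> ennreal t}" by (simp only: closed_Compl)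
  moreover have "eventually (\<lambda>x. f x < ennreal t) at_infinity"
    using order_tendstoD(2)[OF lim] t by simp
  then obtain b where "\<And>x. norm x \<ge> b \<Longrightarrow> f x < ennreal t"
    by (auto simp: eventually_at_infinity)
  then have "norm x \<le> b" if "f x \<ge> ennreal t" for x
    using that by (meson linear not_le)
  then have "bounded {x. f x \<ge> ennreal t}" by (auto simp: bounded_iff)
  ultimately show ?thesis by (simp add: compact_eq_bounded_closed)
qed

lemma convex_level_set: "f \<in> Q_class \<Longrightarrow> convex {x. f x \<ge> t}"
  by (simp add: Q_class_def quasi_concave_def)

text \<open>
  The volumes of the parallel bodies of the level sets are decreasing in \<open>t\<close>, and the
  quermassintegral is a linear combination of them. Monotonicity is only available on \<open>t > 0\<close>,
  where the volumes may be unbounded near 0, so measurability is first shown on this half-line.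
\<close>
lemma measurable_quermass_level_set:
  fixes h :: "real^'n \<Rightarrow> ennreal"
  assumes h: "\<And>t. t > 0 \<Longrightarrow> compact {x. h x \<ge> ennreal t}" "\<And>t. t > 0 \<Longrightarrow> convex {x. h x \<ge> ennreal t}"
    and i: "i \<le> CARD('n)"
  shows "(\<lambda>t. ennreal (quermass i {x. h x \<ge> ennreal t}) * indicator {0<..} t)
    \<in> borel_measurable lborel"
proof -
  let ?R = "restrict_space borel {0<..} :: real measure"
  let ?V = "\<lambda>j t. measure lebesgue (parallel_body {x. h x \<ge> ennreal t} (real j))"
  obtain c where c: "\<And>K :: (real^'n) set. compact K \<Longrightarrow> convex K \<Longrightarrow>
      quermass i K = (\<Sum>j\<le>CARD('n). c j * measure lebesgue (parallel_body K (real j)))"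
    using quermass_from_volumes[OF i] by blast
  have V: "?V j \<in> borel_measurable ?R" for j
  proof -
    have "mono_on {0<..} (\<lambda>t. - ?V j t)"
    proof (rule mono_onI)
      fix s t :: real
      assume "s \<in> {0<..}" "t \<in> {0<..}" "s \<le> t"
      then show "- ?V j s \<le> - ?V j t"
        by (auto intro!: measure_parallel_body_mono parallel_body_mono h(1)
            elim: order_trans[rotated] simp: ennreal_leI)
    qed
    then have "(\<lambda>t. - (- ?V j t)) \<in> borel_measurable ?R"
      by (intro borel_measurable_uminus borel_measurable_mono_on_fnc)
    then show ?thesis by simp
  qed
  have "(\<lambda>t. quermass i {x. h x \<ge> ennreal t}) \<in> borel_measurable ?R"
  proof (rule measurable_cong[THEN iffD2])
    show "quermass i {x. h x \<ge> ennreal t} = (\<Sum>j\<le>CARD('n). c j * ?V j t)" if "t \<in> space ?R" for t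
      using that by (intro c h) (auto simp: space_restrict_space)
    show "(\<lambda>t. \<Sum>j\<le>CARD('n). c j * ?V j t) \<in> borel_measurable ?R"
      using V by (intro borel_measurable_sum borel_measurable_times borel_measurable_const)
  qed
  then have "(\<lambda>t. ennreal (quermass i {x. h x \<ge> ennreal t})) \<in> borel_measurable ?R"
    by simp
  then show ?thesis
    by (subst (asm) borel_measurable_restrict_space_iff_ennreal) auto
qed

theorem proposition5p6:
  fixes f g :: "real ^ 'n \<Rightarrow> ennreal"
  assumes "f \<in> Q_class" and "g \<in> Q_class"
    and "(\<lambda>x. max (f x) (g x)) \<in> Q_class"
  shows "\<forall>i < CARD('n).
           quermass_fun i (\<lambda>x. min (f x) (g x)) + quermass_fun i (\<lambda>x. max (f x) (g x))
           = quermass_fun i f + quermass_fun i g"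
proof (intro allI impI)
  fix i assume "i < CARD('n)"
  then have i: "i \<le> CARD('n)" by simp
  let ?F = "\<lambda>t. {x. f x \<ge> ennreal t}" and ?G = "\<lambda>t. {x. g x \<ge> ennreal t}"
  have min_level: "{x. min (f x) (g x) \<ge> ennreal t} = ?F t \<inter> ?G t"
    and max_level: "{x. max (f x) (g x) \<ge> ennreal t} = ?F t \<union> ?G t" for t
    by (auto simp: le_max_iff_disj)
  have compact: "compact (?F t)" "compact (?G t)" if "t > 0" for t
    using assms compact_level_set that by auto
  have convex: "convex (?F t)" "convex (?G t)" "convex (?F t \<union> ?G t)" for t
    using assms(1,2) convex_level_set[OF assms(3), of "ennreal t"]
    by (auto simp: convex_level_set max_level)
  let ?I = "\<lambda>h t. ennreal (quermass i {x. h x \<ge> ennreal t}) * indicator {0<..} t"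
  have measurable: "?I f \<in> borel_measurable lborel" "?I g \<in> borel_measurable lborel"
      "?I (\<lambda>x. min (f x) (g x)) \<in> borel_measurable lborel"
      "?I (\<lambda>x. max (f x) (g x)) \<in> borel_measurable lborel"
    by (intro measurable_quermass_level_set i;
        auto simp only: min_level max_level intro!: compact convex compact_Int compact_Un convex_Int)+
  have "?I (\<lambda>x. min (f x) (g x)) t + ?I (\<lambda>x. max (f x) (g x)) t = ?I f t + ?I g t" for t
  proof (cases "t > 0")
    case True
    \<comment> \<open>Nonnegativity ensures that the passage to extended nonnegative reals is additive.\<close>
    have "ennreal (quermass i (?F t \<inter> ?G t)) + ennreal (quermass i (?F t \<union> ?G t))
        = ennreal (quermass i (?F t)) + ennreal (quermass i (?G t))"
      using quermass_valuation[OF compact(1)[OF True] convex(1) compact(2)[OF True] convex(2,3) i]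
      by (simp add: quermass_nonneg compact convex compact_Int compact_Un convex_Int i True
          flip: ennreal_plus)
    then show ?thesis using True by (simp only: min_level max_level) simp
  qed simp
  then show "quermass_fun i (\<lambda>x. min (f x) (g x)) + quermass_fun i (\<lambda>x. max (f x) (g x))
      = quermass_fun i f + quermass_fun i g"
    unfolding quermass_fun_def using measurable by (simp flip: nn_integral_add)
qed

end
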